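(* Let $P_0,P_1$ be probability measures on a measurable space $\mathcal X$ with $P_1\ll P_0$, $L:=dP_1/dP_0$ and $D_{\mathrm{KL}}(P_1\|P_0)<\infty$. Let $s:\mathcal X\to\mathbb R$ be measurable such that the CDF $F_{s,P_0}$ of $s(X)$ under $X\sim P_0$ is continuous. Define $T_s(x):=F_{s,P_0}(s(x))$ and let $H_s$ be the law of $T_s(X)$ under $X\sim P_1$. Then $T_s(X)\sim U$ under $X\sim P_0$ and $$D_{\mathrm{KL}}(H_s\|U)\le D_{\mathrm{KL}}(P_1\|P_0).$$ Equality holds if and only if $L$ is $\sigma(T_s)$-measurable, up to $P_0$-null sets. In particular, if the distribution of $L(X)$ under $X\sim P_0$ is continuous (has continuous CDF), the likelihood-ratio score $s^*(x):=L(x)$ satisfies $D_{\mathrm{KL}}(H_{s^*}\|U)=D_{\mathrm{KL}}(P_1\|P_0)$.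
   Context: $U$ denotes the uniform distribution on $[0,1]$, and $D_{\mathrm{KL}}(P\|Q):=\int\log\frac{dP}{dQ}\,dP$ if $P\ll Q$ and $+\infty$ otherwise. *)

theory Defs
  imports "HOL-Probability.Probability"
begin

text \<open>
  The library's \<^const>\<open>KL_divergence\<close> is real-valued and returns 0 whenever the log-likelihood
  ratio is not integrable, so it cannot express the value \<open>+\<infinity>\<close>.  The divergence below is the
  extended-real integral of the library's \<^const>\<open>entropy_density\<close> (natural logarithm), taken as the
  integral of the positive part minus that of the negative part.  For finite measures
  \<open>P \<ll> Q\<close> on the same measurable space the negative part is always integrable, so the
  difference is never \<open>\<infinity> - \<infinity>\<close>.  Note that the library writes \<open>P \<ll> Q\<close> as
  \<open>absolutely_continuous Q P\<close>.
\<close>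

definition D_KL :: "'a measure \<Rightarrow> 'a measure \<Rightarrow> ereal" where
  "D_KL P Q =
    (if absolutely_continuous Q P
     then enn2ereal (\<integral>\<^sup>+ x. ennreal (entropy_density (exp 1) Q P x) \<partial>P)
        - enn2ereal (\<integral>\<^sup>+ x. ennreal (- entropy_density (exp 1) Q P x) \<partial>P)
     else \<infinity>)"

lemma D_KL_eq_KL_divergence:
  assumes "absolutely_continuous Q P" and "integrable P (entropy_density (exp 1) Q P)"
  shows "D_KL P Q = ereal (KL_divergence (exp 1) Q P)"
proof -
  let ?f = "entropy_density (exp 1) Q P"
  have "(\<integral>\<^sup>+ x. ennreal (?f x) \<partial>P) \<noteq> \<infinity>" "(\<integral>\<^sup>+ x. ennreal (- ?f x) \<partial>P) \<noteq> \<infinity>"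
    using assms(2) by (auto simp: real_integrable_def)
  then obtain a b where "0 \<le> a" "(\<integral>\<^sup>+ x. ennreal (?f x) \<partial>P) = ennreal a"
      and "0 \<le> b" "(\<integral>\<^sup>+ x. ennreal (- ?f x) \<partial>P) = ennreal b"
    by (metis ennreal_cases infinity_ennreal_def)
  with assms show ?thesis
    by (simp add: D_KL_def KL_divergence_def real_lebesgue_integral_def)
qed

text \<open>The uniform distribution on \<open>[0,1]\<close>, as a Borel measure on the real line.\<close>

definition unif01 :: "real measure" where
  "unif01 = uniform_measure lborel {0..1}"

definition score_cdf :: "'a measure \<Rightarrow> ('a \<Rightarrow> real) \<Rightarrow> real \<Rightarrow> real" where
  "score_cdf P s = cdf (distr P borel s)"

definition cdf_transform :: "'a measure \<Rightarrow> ('a \<Rightarrow> real) \<Rightarrow> 'a \<Rightarrow> real" where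
  "cdf_transform P s x = score_cdf P s (s x)"

definition transform_law :: "'a measure \<Rightarrow> 'a measure \<Rightarrow> ('a \<Rightarrow> real) \<Rightarrow> real measure" where
  "transform_law P0 P1 s = distr P1 borel (cdf_transform P0 s)"

text \<open>
  \<open>f\<close> is \<open>\<sigma>(T)\<close>-measurable up to \<open>P\<close>-null sets: it agrees \<open>P\<close>-almost everywhere with a function
  that is measurable for the \<open>\<sigma>\<close>-algebra generated by \<open>T\<close>.
\<close>

definition sigma_measurable_upto_null ::
    "'a measure \<Rightarrow> ('a \<Rightarrow> real) \<Rightarrow> ('a \<Rightarrow> real) \<Rightarrow> bool" where
  "sigma_measurable_upto_null P T f \<longleftrightarrow>
    (\<exists>g \<in> borel_measurable (vimage_algebra (space P) T borel). AE x in P. f x = g x)"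

end

theory Submission
  imports Defs
begin

text \<open>Write \<open>T\<close> for \<open>cdf_transform P0 s\<close>. By the probability
  integral transform (\<open>distr_cdf_transform_uniform\<close>), \<open>T\<close> pushes
  \<open>P0\<close> forward to the uniform law, so the inequality is data processing for the map
  \<open>T\<close> (\<open>D_KL_data_processing\<close>).

  Let \<open>f\<close> be the density of \<open>P1\<close> and \<open>h\<close> the density of the
  image of \<open>P1\<close> with respect to the image of \<open>P0\<close>. Then
  \<open>h \<circ> T\<close> is the conditional expectation of \<open>f\<close> given
  \<open>T\<close>, and the loss of divergence is the integral of the pointwise Bregman divergence
  of \<open>u * ln u\<close> between \<open>f\<close> and \<open>h \<circ> T\<close>
  (\<open>data_processing_integral\<close>). It is nonnegative and vanishes exactly when
  \<open>f = h \<circ> T\<close> almost everywhere. That in turn means that \<open>f\<close> has a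
  version measurable for the sigma-algebra of \<open>T\<close>, since such a version and
  \<open>h \<circ> T\<close> have the same integral over each set of that sigma-algebra
  (\<open>density_eq_pushforward_if_sigma_measurable\<close>).

  For the likelihood-ratio score it remains to see that a score with continuous CDF can be recovered
  almost surely from its transform (\<open>score_sigma_measurable_cdf_transform\<close>); the
  equality criterion then holds with \<open>s = L\<close>.\<close>

section \<open>Divergence of a density as an integral of \<open>f * ln f\<close>\<close>

lemma AE_pos_density:
  fixes f :: "'a \<Rightarrow> real"
  assumes [measurable]: "f \<in> borel_measurable M"
  shows "AE x in density M (\<lambda>x. ennreal (f x)). 0 < f x"
  by (subst AE_density) auto

text \<open>\<open>RN_deriv\<close> is some choice of density, but densities are unique almost
  everywhere. Passing to the density measure leaves only points with \<open>f x > 0\<close>, where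
  the truncation by \<open>ennreal\<close> is harmless.\<close>

lemma entropy_density_density_AE:
  fixes f :: "'a \<Rightarrow> real"
  assumes "sigma_finite_measure M" and [measurable]: "f \<in> borel_measurable M"
  shows "AE x in density M (\<lambda>x. ennreal (f x)).
    entropy_density (exp 1) M (density M (\<lambda>x. ennreal (f x))) x = ln (f x)"
proof -
  interpret sigma_finite_measure M by fact
  let ?N = "density M (\<lambda>x. ennreal (f x))"
  have "density M (RN_deriv M ?N) = ?N"
    by (intro density_RN_deriv_density) auto
  then have "AE x in M. RN_deriv M ?N x = ennreal (f x)"
    by (intro density_unique) auto
  then have "AE x in ?N. RN_deriv M ?N x = ennreal (f x)"
    by (subst AE_density) auto
  with AE_pos_density[OF assms(2)] show ?thesis
    by eventually_elim (simp add: entropy_density_def log_def)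
qed

text \<open>The inequality \<open>ln z \<le> z - 1\<close> at \<open>z = 1 / y\<close> bounds
  \<open>- (y * ln y)\<close> by 1, and the measure is finite. Hence only the positive part can make
  a divergence infinite.\<close>

lemma nn_integral_neg_mult_ln_finite:
  fixes f :: "'a \<Rightarrow> real"
  assumes "finite_measure M" and nn: "AE x in M. 0 \<le> f x"
  shows "(\<integral>\<^sup>+ x. ennreal (- (f x * ln (f x))) \<partial>M) < \<infinity>"
proof -
  interpret finite_measure M by fact
  have "- (y * ln y) \<le> 1" if "0 \<le> y" for y :: real
  proof (cases "y = 0")
    case False
    with that have "0 < y" by simp
    then have "y * ln (1 / y) \<le> y * (1 / y - 1)"
      by (intro mult_left_mono ln_le_minus_one) auto
    with \<open>0 < y\<close> show ?thesis by (simp add: ln_div algebra_simps)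
  qed simp
  with nn have "AE x in M. ennreal (- (f x * ln (f x))) \<le> 1"
    by (auto elim!: eventually_mono intro!: ennreal_leI simp flip: ennreal_1)
  then have "(\<integral>\<^sup>+ x. ennreal (- (f x * ln (f x))) \<partial>M) \<le> (\<integral>\<^sup>+ x. 1 \<partial>M)"
    by (rule nn_integral_mono_AE)
  also have "\<dots> < \<infinity>" by (simp add: less_top[symmetric])
  finally show ?thesis .
qed

text \<open>Truncating \<open>g\<close> at 0 commutes with multiplication by a nonnegative
  \<open>f\<close>, so the formula serves for the positive and the negative part of a signed
  integrand.\<close>

lemma nn_integral_real_density:
  fixes f g :: "'a \<Rightarrow> real"
  assumes [measurable]: "f \<in> borel_measurable M" "g \<in> borel_measurable M"
    and nn: "AE x in M. 0 \<le> f x"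
  shows "(\<integral>\<^sup>+ x. ennreal (g x) \<partial>density M (\<lambda>x. ennreal (f x))) = (\<integral>\<^sup>+ x. ennreal (f x * g x) \<partial>M)"
  using nn by (subst nn_integral_density) (auto intro!: nn_integral_cong_AE simp: ennreal_mult')

text \<open>The two integrals in \<open>D_KL\<close> are those of the positive and negative parts of
  \<open>f * ln f\<close> under \<open>M\<close>. The negative one is always finite, so an infinite
  positive one would make the divergence infinite.\<close>

lemma D_KL_finite_integrable:
  fixes f :: "'a \<Rightarrow> real"
  assumes "finite_measure M" and f[measurable]: "f \<in> borel_measurable M" and nn: "AE x in M. 0 \<le> f x"
    and fin: "D_KL (density M (\<lambda>x. ennreal (f x))) M < \<infinity>"
  shows "integrable M (\<lambda>x. f x * ln (f x))"
proof -
  interpret finite_measure M by fact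
  let ?N = "density M (\<lambda>x. ennreal (f x))"
  let ?e = "entropy_density (exp 1) M ?N"
  have ac: "absolutely_continuous M ?N"
    by (intro absolutely_continuousI_density) auto
  note e = entropy_density_density_AE[OF sigma_finite_measure_axioms f]
  have "(\<integral>\<^sup>+ x. ennreal (?e x) \<partial>?N) = (\<integral>\<^sup>+ x. ennreal (ln (f x)) \<partial>?N)"
    using e by (intro nn_integral_cong_AE) auto
  then have pos: "(\<integral>\<^sup>+ x. ennreal (?e x) \<partial>?N) = (\<integral>\<^sup>+ x. ennreal (f x * ln (f x)) \<partial>M)"
    using nn by (simp add: nn_integral_real_density)
  have "(\<integral>\<^sup>+ x. ennreal (- ?e x) \<partial>?N) = (\<integral>\<^sup>+ x. ennreal (- ln (f x)) \<partial>?N)"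
    using e by (intro nn_integral_cong_AE) auto
  then have neg: "(\<integral>\<^sup>+ x. ennreal (- ?e x) \<partial>?N) = (\<integral>\<^sup>+ x. ennreal (- (f x * ln (f x))) \<partial>M)"
    using nn by (simp add: nn_integral_real_density)
  have negfin: "(\<integral>\<^sup>+ x. ennreal (- (f x * ln (f x))) \<partial>M) < \<infinity>"
    by (rule nn_integral_neg_mult_ln_finite[OF finite_measure_axioms nn])
  have "(\<integral>\<^sup>+ x. ennreal (f x * ln (f x)) \<partial>M) \<noteq> \<infinity>"
  proof
    assume "(\<integral>\<^sup>+ x. ennreal (f x * ln (f x)) \<partial>M) = \<infinity>"
    moreover obtain c where "0 \<le> c" "(\<integral>\<^sup>+ x. ennreal (- (f x * ln (f x))) \<partial>M) = ennreal c"
      using negfin by (cases "\<integral>\<^sup>+ x. ennreal (- (f x * ln (f x))) \<partial>M") auto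
    ultimately show False
      using fin ac unfolding D_KL_def pos neg by simp
  qed
  with negfin show ?thesis
    unfolding real_integrable_def by auto
qed

lemma D_KL_density:
  fixes f :: "'a \<Rightarrow> real"
  assumes "sigma_finite_measure M" and f[measurable]: "f \<in> borel_measurable M" and nn: "AE x in M. 0 \<le> f x"
    and int: "integrable M (\<lambda>x. f x * ln (f x))"
  shows "D_KL (density M (\<lambda>x. ennreal (f x))) M = ereal (\<integral>x. f x * ln (f x) \<partial>M)"
proof -
  interpret sigma_finite_measure M by fact
  let ?N = "density M (\<lambda>x. ennreal (f x))"
  have ac: "absolutely_continuous M ?N"
    by (intro absolutely_continuousI_density) auto
  have "integrable ?N (\<lambda>x. ln (f x))"
    using nn int by (subst integrable_real_density) auto
  then have "integrable ?N (entropy_density (exp 1) M ?N)"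
  proof (rule integrable_cong_AE_imp)
    show "entropy_density (exp 1) M ?N \<in> borel_measurable ?N"
      using measurable_entropy_density[of "exp 1" M ?N] by simp
    show "AE x in ?N. ln (f x) = entropy_density (exp 1) M ?N x"
      using entropy_density_density_AE[OF sigma_finite_measure_axioms f] by eventually_elim simp
  qed
  with ac have "D_KL ?N M = ereal (KL_divergence (exp 1) M ?N)"
    by (rule D_KL_eq_KL_divergence)
  with nn show ?thesis
    by (simp add: KL_density log_def)
qed

text \<open>For \<open>u > 0\<close> the expression is \<open>u * (t - 1 - ln t)\<close> with
  \<open>t = v / u\<close>, and \<open>ln t \<le> t - 1\<close> is strict except at
  \<open>t = 1\<close>; for \<open>u = 0\<close> it is just \<open>v\<close>. The third hypothesis
  excludes \<open>u > 0\<close> with \<open>v = 0\<close>, where \<open>ln 0\<close> is only a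
  default value.\<close>

lemma Bregman_ln:
  fixes u v :: real
  assumes "0 \<le> u" "0 \<le> v" "v = 0 \<longrightarrow> u = 0"
  shows "0 \<le> u * ln u - u * ln v - u + v"
    and "u * ln u - u * ln v - u + v = 0 \<longleftrightarrow> u = v"
proof -
  have "0 \<le> u * ln u - u * ln v - u + v \<and> (u * ln u - u * ln v - u + v = 0 \<longleftrightarrow> u = v)"
  proof (cases "u = 0")
    case False
    with assms have "0 < u" "0 < v" by auto
    then have eq: "u * ln u - u * ln v - u + v = u * (v / u - 1 - ln (v / u))"
      by (simp add: ln_div field_simps)
    have "0 \<le> v / u - 1 - ln (v / u)"
      using ln_le_minus_one[of "v / u"] \<open>0 < u\<close> \<open>0 < v\<close> by simp
    moreover have "v / u - 1 - ln (v / u) = 0 \<longleftrightarrow> u = v"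
      using ln_eq_minus_one[of "v / u"] \<open>0 < u\<close> \<open>0 < v\<close> by auto
    ultimately show ?thesis
      unfolding eq using \<open>0 < u\<close> by simp
  qed (use assms in auto)
  then show "0 \<le> u * ln u - u * ln v - u + v"
    and "u * ln u - u * ln v - u + v = 0 \<longleftrightarrow> u = v" by auto
qed

section \<open>The pushforward density and its pullback \<open>h \<circ> T\<close>\<close>

text \<open>Null sets of an image measure are those with null preimage, so absolute continuity
  survives the pushforward and Radon-Nikodym applies on \<open>S\<close>.\<close>

lemma distr_density_obtain:
  fixes f :: "'a \<Rightarrow> real"
  assumes "prob_space M" and [measurable]: "f \<in> borel_measurable M"
    and N: "prob_space (density M (\<lambda>x. ennreal (f x)))"
    and T[measurable]: "T \<in> measurable M S"
  obtains h :: "'b \<Rightarrow> real" where "h \<in> borel_measurable S" "\<And>y. 0 \<le> h y"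
    "density (distr M S T) (\<lambda>y. ennreal (h y)) = distr (density M (\<lambda>x. ennreal (f x))) S T"
proof -
  let ?N = "density M (\<lambda>x. ennreal (f x))"
  interpret prob_space M by fact
  interpret N: prob_space ?N by fact
  interpret Q0: prob_space "distr M S T" by (rule prob_space_distr) fact
  interpret Q1: prob_space "distr ?N S T" by (rule N.prob_space_distr) simp
  have "absolutely_continuous M ?N"
    by (intro absolutely_continuousI_density) auto
  then have ac: "absolutely_continuous (distr M S T) (distr ?N S T)"
    unfolding absolutely_continuous_def by (auto simp: null_sets_distr_iff)
  obtain h where h: "h \<in> borel_measurable (distr M S T)"
    "AE y in distr M S T. RN_deriv (distr M S T) (distr ?N S T) y = ennreal (h y)"
    "\<And>y. 0 \<le> h y"
    by (rule Q0.real_RN_deriv[OF Q1.finite_measure_axioms ac]) (simp, blast)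
  have "density (distr M S T) (\<lambda>y. ennreal (h y)) =
      density (distr M S T) (RN_deriv (distr M S T) (distr ?N S T))"
    using h by (intro density_cong) auto
  also have "\<dots> = distr ?N S T"
    using ac by (intro Q0.density_RN_deriv) auto
  finally show thesis
    using h by (intro that[of h]) auto
qed

context
  fixes M :: "'a measure" and S :: "'b measure" and T :: "'a \<Rightarrow> 'b"
    and f :: "'a \<Rightarrow> real" and h :: "'b \<Rightarrow> real"
  assumes M: "prob_space M"
    and N: "prob_space (density M (\<lambda>x. ennreal (f x)))"
    and f[measurable]: "f \<in> borel_measurable M" and f_nn: "AE x in M. 0 \<le> f x"
    and T[measurable]: "T \<in> measurable M S"
    and h[measurable]: "h \<in> borel_measurable S" and h_nn: "\<And>y. 0 \<le> h y"
    and push: "density (distr M S T) (\<lambda>y. ennreal (h y)) = distr (density M (\<lambda>x. ennreal (f x))) S T"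
begin

interpretation prob_space M by (rule M)
interpretation N: prob_space "density M (\<lambda>x. ennreal (f x))" by (rule N)
interpretation Q0: prob_space "distr M S T" by (rule prob_space_distr[OF T])

text \<open>The pushed-forward law lives on \<open>h > 0\<close>, hence the original one on
  \<open>h \<circ> T > 0\<close>. This supplies the side condition of \<open>Bregman_ln\<close> with
  \<open>u = f x\<close> and \<open>v = h (T x)\<close>.\<close>

lemma pushforward_density_zero: "AE x in M. h (T x) = 0 \<longrightarrow> f x = 0"
proof -
  have "AE y in distr (density M (\<lambda>x. ennreal (f x))) S T. 0 < h y"
    unfolding push[symmetric] by (intro AE_pos_density) simp
  then have "AE x in density M (\<lambda>x. ennreal (f x)). 0 < h (T x)"
    by (rule AE_distrD[rotated]) simp
  then have "AE x in M. 0 < ennreal (f x) \<longrightarrow> 0 < h (T x)"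
    by (subst (asm) AE_density) auto
  with f_nn show ?thesis
    by eventually_elim (auto simp: order.order_iff_strict)
qed

lemma pushforward_density_integrable: "integrable M (\<lambda>x. h (T x))"
  and pushforward_density_integral: "(\<integral>x. h (T x) \<partial>M) = 1"
  and density_integrable: "integrable M f"
  and density_integral: "(\<integral>x. f x \<partial>M) = 1"
proof -
  let ?N = "density M (\<lambda>x. ennreal (f x))"
  interpret Q1: prob_space "distr ?N S T" by (rule N.prob_space_distr) simp
  have "integrable (density (distr M S T) (\<lambda>y. ennreal (h y))) (\<lambda>_. 1 :: real)"
    unfolding push by simp
  then show "integrable M (\<lambda>x. h (T x))"
    using h_nn by (subst (asm) integrable_real_density) (auto simp: integrable_distr_eq)
  have "(\<integral>x. h (T x) \<partial>M) = (\<integral>y. h y * 1 \<partial>distr M S T)"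
    by (simp add: integral_distr)
  also have "\<dots> = (\<integral>y. 1 \<partial>distr ?N S T)"
    unfolding push[symmetric] using h_nn by (subst integral_real_density) auto
  finally show "(\<integral>x. h (T x) \<partial>M) = 1" using Q1.prob_space by simp
  have "integrable ?N (\<lambda>_. 1 :: real)" by simp
  then show "integrable M f"
    using f_nn by (subst (asm) integrable_real_density) auto
  have "(\<integral>x. f x \<partial>M) = (\<integral>x. 1 \<partial>?N)"
    using f_nn by (subst integral_real_density) auto
  then show "(\<integral>x. f x \<partial>M) = 1" using N.prob_space by simp
qed

text \<open>Both sides are the integral of the positive part of \<open>k\<close> under the
  pushed-forward law. This is the defining property of \<open>h \<circ> T\<close> as conditional
  expectation of \<open>f\<close> given \<open>T\<close>.\<close>

lemma nn_integral_pushforward_density: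
  fixes k :: "'b \<Rightarrow> real"
  assumes [measurable]: "k \<in> borel_measurable S"
  shows "(\<integral>\<^sup>+ y. ennreal (h y * k y) \<partial>distr M S T) = (\<integral>\<^sup>+ x. ennreal (f x * k (T x)) \<partial>M)"
proof -
  have "(\<integral>\<^sup>+ y. ennreal (h y * k y) \<partial>distr M S T)
      = (\<integral>\<^sup>+ y. ennreal (k y) \<partial>density (distr M S T) (\<lambda>y. ennreal (h y)))"
    using h_nn by (intro nn_integral_real_density[symmetric]) auto
  also have "\<dots> = (\<integral>\<^sup>+ x. ennreal (k (T x)) \<partial>density M (\<lambda>x. ennreal (f x)))"
    unfolding push by (subst nn_integral_distr) auto
  also have "\<dots> = (\<integral>\<^sup>+ x. ennreal (f x * k (T x)) \<partial>M)"
    using f_nn by (intro nn_integral_real_density) auto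
  finally show ?thesis .
qed

text \<open>
  Comparing \<open>f\<close> with \<open>h \<circ> T\<close> on the original space gives
  \<open>D(f\<cdot>M \<parallel> M) - D(h\<cdot>T(M) \<parallel> T(M)) = \<integral> f ln f - f ln (h \<circ> T) - f + h \<circ> T\<close>, whose integrand is
  nonnegative and vanishes only where \<open>f = h \<circ> T\<close>.
\<close>

context
  assumes int: "integrable M (\<lambda>x. f x * ln (f x))"
begin

text \<open>\<open>Bregman_ln\<close> bounds \<open>f * ln (h \<circ> T)\<close> above by
  \<open>f * ln f - f + h \<circ> T\<close>, which is integrable. Transferring to \<open>S\<close>
  with \<open>k = ln \<circ> h\<close> controls the positive part; the negative part is always
  finite.\<close>

lemma pushforward_entropy_integrable: "integrable (distr M S T) (\<lambda>y. h y * ln (h y))"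
proof -
  have "AE x in M. f x * ln (h (T x)) \<le> \<bar>f x * ln (f x)\<bar> + \<bar>f x\<bar> + \<bar>h (T x)\<bar>"
    using f_nn pushforward_density_zero
  proof eventually_elim
    case (elim x)
    then show ?case
      using Bregman_ln(1)[of "f x" "h (T x)"] h_nn[of "T x"] by simp
  qed
  then have "AE x in M. ennreal (f x * ln (h (T x))) \<le> ennreal (\<bar>f x * ln (f x)\<bar> + \<bar>f x\<bar> + \<bar>h (T x)\<bar>)"
    by eventually_elim (rule ennreal_leI)
  then have "(\<integral>\<^sup>+ x. ennreal (f x * ln (h (T x))) \<partial>M)
      \<le> (\<integral>\<^sup>+ x. ennreal (\<bar>f x * ln (f x)\<bar> + \<bar>f x\<bar> + \<bar>h (T x)\<bar>) \<partial>M)"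
    by (rule nn_integral_mono_AE)
  also have "\<dots> < \<infinity>"
  proof -
    have "integrable M (\<lambda>x. \<bar>f x * ln (f x)\<bar> + \<bar>f x\<bar> + \<bar>h (T x)\<bar>)"
      using int density_integrable pushforward_density_integrable by (intro Bochner_Integration.integrable_add integrable_abs)
    then show ?thesis
      by (auto simp: real_integrable_def less_top)
  qed
  finally have "(\<integral>\<^sup>+ y. ennreal (h y * ln (h y)) \<partial>distr M S T) \<noteq> \<infinity>"
    by (simp add: nn_integral_pushforward_density)
  moreover have "(\<integral>\<^sup>+ y. ennreal (- (h y * ln (h y))) \<partial>distr M S T) \<noteq> \<infinity>"
    using nn_integral_neg_mult_ln_finite[OF Q0.finite_measure_axioms, of h] h_nn by auto
  ultimately show ?thesis
    unfolding real_integrable_def by simp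
qed

text \<open>Both integrals are that of \<open>ln \<circ> h\<close> under the pushed-forward law, by
  change of variables.\<close>

lemma pushforward_cross_entropy:
  shows "integrable M (\<lambda>x. f x * ln (h (T x)))"
    and "(\<integral>x. f x * ln (h (T x)) \<partial>M) = (\<integral>y. h y * ln (h y) \<partial>distr M S T)"
proof -
  let ?N = "density M (\<lambda>x. ennreal (f x))"
  have "integrable (distr ?N S T) (\<lambda>y. ln (h y))"
    unfolding push[symmetric] using h_nn pushforward_entropy_integrable
    by (subst integrable_real_density) auto
  then have "integrable ?N (\<lambda>x. ln (h (T x)))"
    by (subst (asm) integrable_distr_eq) auto
  then show "integrable M (\<lambda>x. f x * ln (h (T x)))"
    using f_nn by (subst (asm) integrable_real_density) auto
  have "(\<integral>x. f x * ln (h (T x)) \<partial>M) = (\<integral>x. ln (h (T x)) \<partial>?N)"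
    using f_nn by (subst integral_real_density) auto
  also have "\<dots> = (\<integral>y. ln (h y) \<partial>distr ?N S T)"
    by (subst integral_distr) auto
  also have "\<dots> = (\<integral>y. h y * ln (h y) \<partial>distr M S T)"
    unfolding push[symmetric] using h_nn by (subst integral_real_density) auto
  finally show "(\<integral>x. f x * ln (h (T x)) \<partial>M) = (\<integral>y. h y * ln (h y) \<partial>distr M S T)" .
qed

lemma data_processing_integral:
  shows "(\<integral>y. h y * ln (h y) \<partial>distr M S T) \<le> (\<integral>x. f x * ln (f x) \<partial>M)"
    and "(\<integral>y. h y * ln (h y) \<partial>distr M S T) = (\<integral>x. f x * ln (f x) \<partial>M) \<longleftrightarrow>
      (AE x in M. f x = h (T x))"
proof -
  let ?d = "\<lambda>x. f x * ln (f x) - f x * ln (h (T x)) - f x + h (T x)"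
  have d_int: "integrable M ?d"
    using int pushforward_cross_entropy(1) density_integrable pushforward_density_integrable by simp
  \<comment> \<open>The terms \<open>- f\<close> and \<open>h \<circ> T\<close> cancel under the
    integral because both have total mass 1; they serve only to make the integrand pointwise
    nonnegative.\<close>
  have d_eq: "(\<integral>x. ?d x \<partial>M) = (\<integral>x. f x * ln (f x) \<partial>M) - (\<integral>y. h y * ln (h y) \<partial>distr M S T)"
    using int pushforward_cross_entropy density_integrable pushforward_density_integrable
      density_integral pushforward_density_integral
    by simp
  have d_nn: "AE x in M. 0 \<le> ?d x"
    using f_nn pushforward_density_zero
    by eventually_elim (auto intro!: Bregman_ln(1) h_nn)
  show "(\<integral>y. h y * ln (h y) \<partial>distr M S T) \<le> (\<integral>x. f x * ln (f x) \<partial>M)"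
    using integral_nonneg_AE[OF d_nn] d_eq by simp
  have "(\<integral>y. h y * ln (h y) \<partial>distr M S T) = (\<integral>x. f x * ln (f x) \<partial>M) \<longleftrightarrow> (AE x in M. ?d x = 0)"
    using integral_nonneg_eq_0_iff_AE[OF d_int d_nn] d_eq by auto
  also have "\<dots> \<longleftrightarrow> (AE x in M. f x = h (T x))"
  proof -
    have "AE x in M. ?d x = 0 \<longleftrightarrow> f x = h (T x)"
      using f_nn pushforward_density_zero
      by eventually_elim (intro Bregman_ln(2) h_nn)
    then show ?thesis by (rule eventually_subst)
  qed
  finally show "(\<integral>y. h y * ln (h y) \<partial>distr M S T) = (\<integral>x. f x * ln (f x) \<partial>M) \<longleftrightarrow>
      (AE x in M. f x = h (T x))" .
qed

end

lemma density_eq_pushforward_if_sigma_measurable: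
  assumes g: "g \<in> borel_measurable (vimage_algebra (space M) T S)"
    and fg: "AE x in M. f x = g x"
  shows "AE x in M. f x = h (T x)"
proof -
  define F where "F = vimage_algebra (space M) T S"
  have TF[measurable]: "T \<in> measurable F S"
    unfolding F_def using measurable_space[OF T] by (intro measurable_vimage_algebra1) auto
  have id[measurable]: "(\<lambda>x. x) \<in> measurable M F"
    unfolding F_def by (rule measurable_vimage_algebra2) auto
  have gF[measurable]: "g \<in> borel_measurable F" using g by (simp add: F_def)
  have gM[measurable]: "g \<in> borel_measurable M"
    using measurable_compose[OF id gF] .
  \<comment> \<open>The pushforward along the identity is the restriction of \<open>M\<close> to the
    sigma-algebra \<open>F\<close> generated by \<open>T\<close>, the only sets on which the
    integrals are compared.\<close>
  let ?M = "distr M F (\<lambda>x. x)"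
  interpret F: prob_space ?M by (rule prob_space_distr[OF id])
  have "density ?M (\<lambda>x. ennreal (g x)) = density ?M (\<lambda>x. ennreal (h (T x)))"
  proof (rule measure_eqI)
    fix A assume "A \<in> sets (density ?M (\<lambda>x. ennreal (g x)))"
    then have AF[measurable]: "A \<in> sets F" by simp
    then obtain B where B[measurable]: "B \<in> sets S" and AB: "A = T -` B \<inter> space M"
      unfolding F_def using measurable_space[OF T] by (auto simp: sets_vimage_algebra2)
    have "emeasure (density ?M (\<lambda>x. ennreal (g x))) A = (\<integral>\<^sup>+ x. ennreal (g x) * indicator A x \<partial>M)"
      by (simp add: emeasure_density nn_integral_distr)
    also have "\<dots> = (\<integral>\<^sup>+ x. ennreal (f x * indicator B (T x)) \<partial>M)"
      using fg AE_space by (intro nn_integral_cong_AE, eventually_elim) (auto simp: AB indicator_def)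
    also have "\<dots> = (\<integral>\<^sup>+ y. ennreal (h y * indicator B y) \<partial>distr M S T)"
      by (rule nn_integral_pushforward_density[symmetric]) simp
    also have "\<dots> = (\<integral>\<^sup>+ x. ennreal (h (T x)) * indicator A x \<partial>M)"
      by (subst nn_integral_distr) (auto intro!: nn_integral_cong simp: AB indicator_def)
    also have "\<dots> = emeasure (density ?M (\<lambda>x. ennreal (h (T x)))) A"
      by (simp add: emeasure_density nn_integral_distr)
    finally show "emeasure (density ?M (\<lambda>x. ennreal (g x))) A =
      emeasure (density ?M (\<lambda>x. ennreal (h (T x)))) A" .
  qed simp
  then have "AE x in ?M. ennreal (g x) = ennreal (h (T x))"
    by (intro F.density_unique) auto
  then have "AE x in M. ennreal (g x) = ennreal (h (T x))"
    by (rule AE_distrD[OF id])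
  \<comment> \<open>Equality under \<open>ennreal\<close> yields real equality because
    \<open>g\<close> agrees almost everywhere with the nonnegative \<open>f\<close>.\<close>
  with fg f_nn show ?thesis
    by eventually_elim (use h_nn in auto)
qed

end

section \<open>Data processing for \<open>D_KL\<close>, with its equality case\<close>

text \<open>Finiteness makes both divergences real integrals, which
  \<open>data_processing_integral\<close> compares. Its equality case \<open>f = h \<circ> T\<close>
  matches the measurability condition, since \<open>h \<circ> T\<close> is itself measurable for the
  sigma-algebra of \<open>T\<close>.\<close>

lemma D_KL_data_processing:
  fixes f :: "'a \<Rightarrow> real" and T :: "'a \<Rightarrow> real"
  assumes M: "prob_space M" and f[measurable]: "f \<in> borel_measurable M"
    and f_nn: "AE x in M. 0 \<le> f x"
    and N: "prob_space (density M (\<lambda>x. ennreal (f x)))"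
    and T[measurable]: "T \<in> borel_measurable M"
    and fin: "D_KL (density M (\<lambda>x. ennreal (f x))) M < \<infinity>"
  shows "D_KL (distr (density M (\<lambda>x. ennreal (f x))) borel T) (distr M borel T)
      \<le> D_KL (density M (\<lambda>x. ennreal (f x))) M"
    and "D_KL (distr (density M (\<lambda>x. ennreal (f x))) borel T) (distr M borel T)
      = D_KL (density M (\<lambda>x. ennreal (f x))) M \<longleftrightarrow> sigma_measurable_upto_null M T f"
proof -
  interpret prob_space M by fact
  interpret Q: prob_space "distr M borel T" by (rule prob_space_distr) fact
  obtain h :: "real \<Rightarrow> real" where h[measurable]: "h \<in> borel_measurable borel" and h_nn: "\<And>y. 0 \<le> h y"
    and push: "density (distr M borel T) (\<lambda>y. ennreal (h y)) = distr (density M (\<lambda>x. ennreal (f x))) borel T"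
    using distr_density_obtain[OF M f N T] by blast
  note ctx = M N f f_nn T h h_nn push
  have int: "integrable M (\<lambda>x. f x * ln (f x))"
    by (rule D_KL_finite_integrable[OF finite_measure_axioms f f_nn fin])
  have KL: "D_KL (density M (\<lambda>x. ennreal (f x))) M = ereal (\<integral>x. f x * ln (f x) \<partial>M)"
    by (rule D_KL_density[OF sigma_finite_measure_axioms f f_nn int])
  have KL': "D_KL (distr (density M (\<lambda>x. ennreal (f x))) borel T) (distr M borel T)
      = ereal (\<integral>y. h y * ln (h y) \<partial>distr M borel T)"
    unfolding push[symmetric] using h_nn pushforward_entropy_integrable[OF ctx int]
    by (intro D_KL_density[OF Q.sigma_finite_measure_axioms]) auto
  show "D_KL (distr (density M (\<lambda>x. ennreal (f x))) borel T) (distr M borel T)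
      \<le> D_KL (density M (\<lambda>x. ennreal (f x))) M"
    unfolding KL KL' using data_processing_integral(1)[OF ctx int] by simp
  have "(AE x in M. f x = h (T x)) \<longleftrightarrow> sigma_measurable_upto_null M T f"
  proof
    assume "AE x in M. f x = h (T x)"
    moreover have "(\<lambda>x. h (T x)) \<in> borel_measurable (vimage_algebra (space M) T borel)"
      by (rule measurable_compose[OF measurable_vimage_algebra1 h]) auto
    ultimately show "sigma_measurable_upto_null M T f"
      unfolding sigma_measurable_upto_null_def by (intro bexI)
  next
    assume "sigma_measurable_upto_null M T f"
    then obtain g where "g \<in> borel_measurable (vimage_algebra (space M) T borel)"
      "AE x in M. f x = g x"
      unfolding sigma_measurable_upto_null_def by (elim bexE)
    then show "AE x in M. f x = h (T x)"
      by (rule density_eq_pushforward_if_sigma_measurable[OF ctx])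
  qed
  then show "D_KL (distr (density M (\<lambda>x. ennreal (f x))) borel T) (distr M borel T)
      = D_KL (density M (\<lambda>x. ennreal (f x))) M \<longleftrightarrow> sigma_measurable_upto_null M T f"
    unfolding KL KL' using data_processing_integral(2)[OF ctx int] by simp
qed

section \<open>Probability integral transform and recovery of the score\<close>

lemma real_distribution_unif01: "real_distribution unif01"
proof -
  interpret prob_space unif01
    unfolding unif01_def by (rule prob_space_uniform_measure) auto
  show ?thesis by unfold_locales (simp add: unif01_def)
qed

lemma cdf_unif01: "cdf unif01 t = max 0 (min 1 t)"
proof -
  have *: "{0..1} \<inter> {..t} = {0..min 1 t}" by auto
  show ?thesis
    unfolding cdf_def unif01_def by (subst measure_uniform_measure) (auto simp: * max_def min_def)
qed

lemma score_cdf_borel_measurable: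
  assumes "prob_space P" "s \<in> borel_measurable P"
  shows "score_cdf P s \<in> borel_measurable borel"
proof -
  interpret real_distribution "distr P borel s"
    using assms by (rule prob_space.real_distribution_distr)
  show ?thesis
    unfolding score_cdf_def by (intro borel_measurable_mono monoI cdf_nondecreasing)
qed

lemma cdf_transform_borel_measurable:
  assumes "prob_space P" "s \<in> borel_measurable P"
  shows "cdf_transform P s \<in> borel_measurable P"
  unfolding cdf_transform_def[abs_def]
  by (rule measurable_compose[OF assms(2) score_cdf_borel_measurable[OF assms]])

text \<open>By continuity the level set \<open>C\<close> of the CDF at \<open>t\<close> is nonempty
  and closed, and \<open>t < 1\<close> bounds it above. Its largest point is therefore the right end
  of \<open>{x. cdf M x \<le> t}\<close>, even if the CDF is flat at level \<open>t\<close>.\<close>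

lemma (in real_distribution) measure_cdf_le:
  assumes cont: "continuous_on UNIV (cdf M)" and t: "0 < t" "t < 1"
  shows "measure M {x. cdf M x \<le> t} = t"
proof -
  have "\<forall>\<^sub>F x in at_top. t < cdf M x"
    using cdf_lim_at_top_prob t by (intro order_tendstoD(1)) auto
  then obtain b where b: "\<And>x. b \<le> x \<Longrightarrow> t < cdf M x"
    by (auto simp: eventually_at_top_linorder)
  have "\<forall>\<^sub>F x in at_bot. cdf M x < t"
    using cdf_lim_at_bot t by (intro order_tendstoD(2)) auto
  then obtain a where a: "\<And>x. x \<le> a \<Longrightarrow> cdf M x < t"
    by (auto simp: eventually_at_bot_linorder)
  define C where "C = {x. cdf M x = t}"
  have "a \<le> b" using a[of "min a b"] b[of "max a b"] a[of b] b[of b] by (cases "a \<le> b") auto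
  then obtain q where "cdf M q = t"
    using IVT'[of "cdf M" a t b] a[of a] b[of b] continuous_on_subset[OF cont, of "{a..b}"] by auto
  then have "C \<noteq> {}" by (auto simp: C_def)
  have "closed C"
    unfolding C_def using cont by (intro closed_Collect_eq) auto
  moreover have bdd: "bdd_above C"
  proof (rule bdd_aboveI[of _ b])
    show "x \<le> b" if "x \<in> C" for x
      using b[of x] that by (cases "x \<le> b") (auto simp: C_def)
  qed
  ultimately have Sup: "Sup C \<in> C"
    using \<open>C \<noteq> {}\<close> by (intro closed_contains_Sup)
  have "cdf M x \<le> t \<longleftrightarrow> x \<le> Sup C" for x
  proof
    assume "x \<le> Sup C"
    then show "cdf M x \<le> t" using cdf_nondecreasing[of x "Sup C"] Sup by (simp add: C_def)
  next
    assume le: "cdf M x \<le> t"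
    show "x \<le> Sup C"
    proof (rule ccontr)
      assume "\<not> x \<le> Sup C"
      then have "Sup C < x" by simp
      then have "t \<le> cdf M x" using cdf_nondecreasing[of "Sup C" x] Sup by (simp add: C_def)
      with le have "x \<in> C" by (simp add: C_def)
      then show False using cSup_upper[OF _ bdd] \<open>Sup C < x\<close> by fastforce
    qed
  qed
  then have "{x. cdf M x \<le> t} = {..Sup C}" by auto
  then show ?thesis using Sup by (simp add: C_def cdf_def)
qed

lemma (in real_distribution) distr_cdf_uniform:
  assumes cont: "continuous_on UNIV (cdf M)"
  shows "distr M borel (cdf M) = unif01"
proof (rule cdf_unique)
  have meas[measurable]: "cdf M \<in> borel_measurable borel"
    by (intro borel_measurable_mono monoI cdf_nondecreasing)
  show "real_distribution (distr M borel (cdf M))"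
    by (intro real_distribution_distr) simp
  show "real_distribution unif01" by (rule real_distribution_unif01)
  have cdf_eq: "cdf (distr M borel (cdf M)) t = measure M {x. cdf M x \<le> t}" for t
    unfolding cdf_def[of "distr M borel (cdf M)"] by (subst measure_distr) (auto simp: vimage_def)
  show "cdf (distr M borel (cdf M)) = cdf unif01"
  proof
    fix t :: real
    consider "t < 0" | "t = 0" | "0 < t" "t < 1" | "1 \<le> t" by linarith
    then show "cdf (distr M borel (cdf M)) t = cdf unif01 t"
    proof cases
      case 1
      then have "{x. cdf M x \<le> t} = {}"
        using cdf_nonneg by (auto simp: not_le intro: less_le_trans)
      with 1 show ?thesis by (simp only: cdf_eq cdf_unif01) simp
    next
      case 2
      \<comment> \<open>The CDF may never attain 0, so the endpoint is reached by letting the level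
        \<open>e\<close> tend to 0.\<close>
      have "measure M {x. cdf M x \<le> 0} \<le> e" if "0 < e" for e
      proof (cases "e < 1")
        case True
        have "measure M {x. cdf M x \<le> 0} \<le> measure M {x. cdf M x \<le> e}"
          using \<open>0 < e\<close> by (intro finite_measure_mono) auto
        with measure_cdf_le[OF cont \<open>0 < e\<close> True] show ?thesis by simp
      next
        case False
        then show ?thesis using prob_le_1[of "{x. cdf M x \<le> 0}"] by linarith
      qed
      then have "measure M {x. cdf M x \<le> 0} \<le> 0" by (rule field_le_epsilon[of _ 0, simplified])
      with 2 show ?thesis by (simp add: cdf_eq cdf_unif01 measure_le_0_iff)
    next
      case 3
      then show ?thesis by (simp add: cdf_eq cdf_unif01 measure_cdf_le[OF cont])
    next
      case 4
      then have "{x. cdf M x \<le> t} = space M"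
        using cdf_bounded_prob order_trans by auto
      with 4 show ?thesis using prob_space by (simp add: cdf_eq cdf_unif01)
    qed
  qed
qed

lemma distr_cdf_transform_uniform:
  assumes P: "prob_space P" and s: "s \<in> borel_measurable P"
    and cont: "continuous_on UNIV (score_cdf P s)"
  shows "distr P borel (cdf_transform P s) = unif01"
proof -
  interpret real_distribution "distr P borel s"
    using P s by (rule prob_space.real_distribution_distr)
  have "distr (distr P borel s) borel (score_cdf P s) = unif01"
    using cont unfolding score_cdf_def by (rule distr_cdf_uniform)
  moreover have "distr (distr P borel s) borel (score_cdf P s) = distr P borel (cdf_transform P s)"
    by (subst distr_distr[OF score_cdf_borel_measurable[OF P s] s])
      (simp add: comp_def cdf_transform_def[abs_def])
  ultimately show ?thesis by simp
qed

text \<open>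
  The transform almost surely avoids the countably many values \<open>F q\<close> with \<open>q\<close> rational, and off
  that event \<open>q < s x \<longleftrightarrow> F q < F (s x)\<close>; hence \<open>s x\<close> is the supremum of the rationals \<open>q\<close> with
  \<open>F q < F (s x)\<close>.
\<close>

lemma score_sigma_measurable_cdf_transform:
  assumes P: "prob_space P" and s[measurable]: "s \<in> borel_measurable P"
    and cont: "continuous_on UNIV (score_cdf P s)"
  shows "sigma_measurable_upto_null P (cdf_transform P s) s"
proof -
  interpret prob_space P by fact
  interpret D: real_distribution "distr P borel s"
    using P s by (rule prob_space.real_distribution_distr)
  let ?F = "score_cdf P s" and ?T = "cdf_transform P s"
  have T[measurable]: "?T \<in> borel_measurable P"
    by (rule cdf_transform_borel_measurable[OF P s])
  have mono: "x \<le> y \<Longrightarrow> ?F x \<le> ?F y" for x y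
    unfolding score_cdf_def by (rule D.cdf_nondecreasing)
  \<comment> \<open>Continuity of the CDF enters here: the transform has the uniform law, which has
    no atoms.\<close>
  have atom: "AE x in P. ?T x \<noteq> c" for c
  proof -
    have "AE u in unif01. u \<noteq> c"
      unfolding unif01_def using AE_lborel_singleton[of c]
      by (intro AE_uniform_measureI) auto
    then show ?thesis
      unfolding distr_cdf_transform_uniform[OF P s cont, symmetric] by (rule AE_distrD[OF T])
  qed
  have "AE x in P. \<forall>q\<in>\<rat>. ?T x \<noteq> ?F q"
    by (rule AE_ball_countable[THEN iffD2, OF countable_rat]) (intro ballI atom)
  then have sup: "AE x in P. s x =
      real_of_ereal (SUP q\<in>\<rat>. if ?F q < ?T x then ereal q else -\<infinity>)"
  proof eventually_elim
    case (elim x)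
    have iff: "?F q < ?T x \<longleftrightarrow> q < s x" if "q \<in> \<rat>" for q
      using elim that mono[of q "s x"] mono[of "s x" q] by (force simp: cdf_transform_def)
    have "(SUP q\<in>\<rat>. if ?F q < ?T x then ereal q else -\<infinity>) = ereal (s x)"
    proof (rule antisym)
      show "(SUP q\<in>\<rat>. if ?F q < ?T x then ereal q else -\<infinity>) \<le> ereal (s x)"
        by (rule SUP_least) (simp add: iff)
      show "ereal (s x) \<le> (SUP q\<in>\<rat>. if ?F q < ?T x then ereal q else -\<infinity>)"
      proof (rule dense_le)
        fix z assume "z < ereal (s x)"
        then obtain r where "z < ereal r" "r < s x"
          by (metis ereal_dense2 ereal_less_eq(3) less_ereal.simps(1))
        then obtain q where "q \<in> \<rat>" "r < q" "q < s x"
          using Rats_dense_in_real by blast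
        then have "z \<le> (if ?F q < ?T x then ereal q else -\<infinity>)"
          using \<open>z < ereal r\<close> by (simp add: iff less_imp_le less_trans[of z "ereal r"])
        then show "z \<le> (SUP q\<in>\<rat>. if ?F q < ?T x then ereal q else -\<infinity>)"
          using \<open>q \<in> \<rat>\<close> by (rule SUP_upper2[rotated])
      qed
    qed
    then show ?case by simp
  qed
  \<comment> \<open>Giving excluded rationals the value \<open>-\<infinity>\<close> keeps the index
    set fixed, so this is a countable supremum of Borel functions of \<open>u\<close>.\<close>
  have "(\<lambda>u. real_of_ereal (SUP q\<in>\<rat>. if ?F q < u then ereal q else -\<infinity>)) \<in> borel_measurable borel"
    using countable_rat by measurable
  then have "(\<lambda>x. real_of_ereal (SUP q\<in>\<rat>. if ?F q < ?T x then ereal q else -\<infinity>))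
      \<in> borel_measurable (vimage_algebra (space P) ?T borel)"
    by (rule measurable_compose[OF measurable_vimage_algebra1, rotated]) auto
  with sup show ?thesis
    unfolding sigma_measurable_upto_null_def by (intro bexI)
qed

theorem proposition3p11:
  fixes P0 P1 :: "'a measure" and L :: "'a \<Rightarrow> real"
  assumes "prob_space P0" and "prob_space P1" and "sets P1 = sets P0"
    and "absolutely_continuous P0 P1"
    and "L \<in> borel_measurable P0" and "\<forall>x\<in>space P0. 0 \<le> L x"
    and "density P0 (\<lambda>x. ennreal (L x)) = P1"
    and "D_KL P1 P0 < \<infinity>"
  shows "(\<forall>s \<in> borel_measurable P0. continuous_on UNIV (score_cdf P0 s) \<longrightarrow>
            distr P0 borel (cdf_transform P0 s) = unif01 \<and>
            D_KL (transform_law P0 P1 s) unif01 \<le> D_KL P1 P0 \<and>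
            (D_KL (transform_law P0 P1 s) unif01 = D_KL P1 P0 \<longleftrightarrow>
               sigma_measurable_upto_null P0 (cdf_transform P0 s) L)) \<and>
         (continuous_on UNIV (score_cdf P0 L) \<longrightarrow>
            D_KL (transform_law P0 P1 L) unif01 = D_KL P1 P0)"
proof -
  have L[measurable]: "L \<in> borel_measurable P0" by fact
  have nn: "AE x in P0. 0 \<le> L x" using assms(6) by (intro AE_I2) auto
  have P1: "P1 = density P0 (\<lambda>x. ennreal (L x))" using assms(7) by simp
  have main: "distr P0 borel (cdf_transform P0 s) = unif01 \<and>
      D_KL (transform_law P0 P1 s) unif01 \<le> D_KL P1 P0 \<and>
      (D_KL (transform_law P0 P1 s) unif01 = D_KL P1 P0 \<longleftrightarrow>
        sigma_measurable_upto_null P0 (cdf_transform P0 s) L)"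
    if s: "s \<in> borel_measurable P0" and cont: "continuous_on UNIV (score_cdf P0 s)" for s
  proof -
    have U: "distr P0 borel (cdf_transform P0 s) = unif01"
      by (rule distr_cdf_transform_uniform[OF assms(1) s cont])
    \<comment> \<open>The reference law in \<open>dp\<close> is the image of \<open>P0\<close>,
      which \<open>U\<close> identifies as \<open>unif01\<close>.\<close>
    note dp = D_KL_data_processing[OF assms(1) L nn assms(2)[unfolded P1]
        cdf_transform_borel_measurable[OF assms(1) s] assms(8)[unfolded P1]]
    show ?thesis
      using U dp unfolding transform_law_def P1 by simp
  qed
  \<comment> \<open>With \<open>s = L\<close>, recovering the score from its transform is exactly
    the equality criterion.\<close>
  moreover have "D_KL (transform_law P0 P1 L) unif01 = D_KL P1 P0"
    if "continuous_on UNIV (score_cdf P0 L)"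
    using main[OF L that] score_sigma_measurable_cdf_transform[OF assms(1) L that] by blast
  ultimately show ?thesis by blast
qed

end
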